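(* Let $\mathcal D$ be a smooth compact convex subset of $\mathbb R^2$ and $O$ an interior point of it. Consider all straight lines $l(\varphi)$ through $O$ and the function $\tilde f(\varphi)=|\tilde A(\varphi)\tilde B(\varphi)|$ where $[\tilde A(\varphi)\tilde B(\varphi)]=l(\varphi)\cap\mathcal D$. Denote by $t_1(\varphi)$ and $t_2(\varphi)$ the tangents to $\partial\mathcal D$ at $\tilde A(\varphi)$ and $\tilde B(\varphi)$, respectively. Then: (i) The function $\tilde f(\varphi)$ is everywhere differentiable. (ii) $\tilde f'(\varphi)=0$ if and only if CPP holds for the lines $t_1(\varphi)$, $t_2(\varphi)$, $l(\varphi)$ and the points $\tilde A(\varphi)$, $\tilde B(\varphi)$, $O$.
   Context: $l(\varphi)$ denotes the line through $O$ obtained by rotating a fixed line through $O$ by the angle $\varphi$ (in radians) around $O$. $|AB|$ is the length of the segment $[AB]$. A line $p$ is tangent to a curve $\gamma\subset\mathbb R^2$ at a point $P_0\in p\cap\gamma$ if there is an open disc $U$ centered at $P_0$ such that, in a rectangular coordinate system with $p$ as abscissa axis, $\gamma\cap U$ is the graph of a continuous real-valued function which is differentiable at $P_0$ with derivative zero there. A convex set $\mathcal D\subset\mathbb R^2$ is smooth if its boundary $\partial\mathcal D$ has a tangent at every point (equivalently, for convex sets with nonempty interior: there is exactly one supporting line at every boundary point, and that line is the tangent). CPP (Concurrent Perpendiculars Property) for lines $l_1\ni A$, $l_2\ni B$, a line $l$ passing through $A,B,O$, and the points $A,B,O$: the perpendicular to $l_1$ at $A$, the perpendicular to $l_2$ at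 $B$ and the perpendicular to $l$ at $O$ have a common point. *)

theory Defs
  imports "HOL-Analysis.Analysis"
begin

definition is_line :: "(real^2) set \<Rightarrow> bool" where
  "is_line L \<longleftrightarrow> affine L \<and> aff_dim L = 1"

definition rotation :: "real^2 \<Rightarrow> real \<Rightarrow> real^2 \<Rightarrow> real^2" where
  "rotation c \<phi> X = c + vector
     [cos \<phi> * (X - c) $ 1 - sin \<phi> * (X - c) $ 2,
      sin \<phi> * (X - c) $ 1 + cos \<phi> * (X - c) $ 2]"

(* (q, e, n) is a rectangular coordinate system: origin q, orthonormal axis directions e and n,
   with p as the abscissa axis. The point P0 has abscissa (P0 - q) \<bullet> e. The function whose graph
   is \<gamma> \<inter> U lives on an open interval I containing that abscissa. *)
definition tangent_at :: "(real^2) set \<Rightarrow> (real^2) set \<Rightarrow> real^2 \<Rightarrow> bool" where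
  "tangent_at p \<gamma> P0 \<longleftrightarrow>
     is_line p \<and> P0 \<in> p \<inter> \<gamma> \<and>
     (\<exists>r>0. \<exists>q e n. q \<in> p \<and> norm e = 1 \<and> norm n = 1 \<and> orthogonal e n \<and>
        p = range (\<lambda>x. q + x *\<^sub>R e) \<and>
        (\<exists>I (g :: real \<Rightarrow> real). open I \<and> connected I \<and> (P0 - q) \<bullet> e \<in> I \<and>
           continuous_on I g \<and>
           (g has_real_derivative 0) (at ((P0 - q) \<bullet> e)) \<and>
           \<gamma> \<inter> ball P0 r = (\<lambda>x. q + x *\<^sub>R e + g x *\<^sub>R n) ` I))"

definition smooth_boundary :: "(real^2) set \<Rightarrow> bool" where
  "smooth_boundary D \<longleftrightarrow> (\<forall>P \<in> frontier D. \<exists>p. tangent_at p (frontier D) P)"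

definition perpendicular_at :: "(real^2) set \<Rightarrow> real^2 \<Rightarrow> (real^2) set" where
  "perpendicular_at L P = {X. \<forall>Y\<in>L. \<forall>Z\<in>L. orthogonal (X - P) (Y - Z)}"

(* Meaningful when l1, l2, l are lines, A \<in> l1, B \<in> l2 and A, B, c \<in> l. *)
definition CPP ::
  "(real^2) set \<Rightarrow> (real^2) set \<Rightarrow> (real^2) set \<Rightarrow> real^2 \<Rightarrow> real^2 \<Rightarrow> real^2 \<Rightarrow> bool" where
  "CPP l1 l2 l A B c \<longleftrightarrow>
     perpendicular_at l1 A \<inter> perpendicular_at l2 B \<inter> perpendicular_at l c \<noteq> {}"

end

theory Submission
  imports Defs
begin

text \<open>
  Write the boundary point in direction \<open>v\<close> as \<open>c + \<rho>(v) v\<close>. Convexity makes \<open>1/\<rho>\<close> globally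
  Lipschitz, so the boundary point is a locally Lipschitz function of \<open>v\<close>. A tangent with
  normal \<open>n\<close> at \<open>P\<close> says that \<open>(X - P) \<bullet> n\<close> vanishes to first order along the boundary;
  composed with the Lipschitz parametrisation, \<open>\<rho>(v) (v \<bullet> n)\<close> is differentiable with derivative
  zero, and dividing by \<open>v \<bullet> n\<close> gives \<open>\<rho>'(v) h = - \<rho>(v) (h \<bullet> n) / (v \<bullet> n)\<close>. The chord length at
  angle \<open>\<phi>\<close> is \<open>\<rho>(u) + \<rho>(-u)\<close> for the unit vector \<open>u\<close> along the line. If \<open>u\<close> is rotated, the
  derivative of \<open>\<rho>(u)\<close> is the signed height over \<open>c\<close> at which the normal at the corresponding
  endpoint meets the perpendicular to the line at \<open>c\<close>; for \<open>-u\<close> this height appears with the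
  opposite sign. Hence the derivative of the sum vanishes iff the two heights agree.
\<close>

section \<open>The radial function of a convex body\<close>

locale convex_body =
  fixes D :: "'a::euclidean_space set" and c :: 'a
  assumes compact: "compact D" and convex: "convex D" and center: "c \<in> interior D"
begin

text \<open>The reciprocal of the Minkowski gauge of \<open>D\<close> seen from \<open>c\<close>. It
  takes all nonzero vectors, not just unit ones, so that it can be differentiated in the ambient
  space. At \<open>v = 0\<close> the set is all of the reals and the supremum says nothing.\<close>

definition radial :: "'a \<Rightarrow> real" where
  "radial v = Sup {s. c + s *\<^sub>R v \<in> D}"

abbreviation radial_point :: "'a \<Rightarrow> 'a" where
  "radial_point v \<equiv> c + radial v *\<^sub>R v"

lemma center_in: "c \<in> D"
  using center interior_subset by blast

lemma
  assumes "v \<noteq> 0"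
  shows radial_point_in: "radial_point v \<in> D"
    and le_radial: "c + s *\<^sub>R v \<in> D \<Longrightarrow> s \<le> radial v"
proof -
  let ?S = "{s. c + s *\<^sub>R v \<in> D}"
  obtain M where M: "\<And>x. x \<in> D \<Longrightarrow> norm (x - c) \<le> M"
  proof -
    have "bounded ((\<lambda>x. x - c) ` D)"
      using compact_imp_bounded[OF compact] bounded_translation_minus by blast
    then show ?thesis using that unfolding bounded_iff by auto
  qed
  have bdd: "bdd_above ?S"
  proof (rule bdd_aboveI)
    fix s assume "s \<in> ?S"
    then have "\<bar>s\<bar> * norm v \<le> M" using M[of "c + s *\<^sub>R v"] by simp
    then have "\<bar>s\<bar> \<le> M / norm v" using assms by (simp add: field_simps)
    then show "s \<le> M / norm v" by linarith
  qed
  have "0 \<in> ?S" using center_in by simp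
  moreover have "closed ?S"
  proof -
    have "?S = (\<lambda>s. c + s *\<^sub>R v) -` D" by auto
    then show ?thesis
      using compact_imp_closed[OF compact]
      by (auto intro!: closed_vimage continuous_intros)
  qed
  ultimately have "Sup ?S \<in> ?S" using closed_contains_Sup[OF _ bdd] by blast
  then show "radial_point v \<in> D" by (simp add: radial_def)
  show "s \<le> radial v" if "c + s *\<^sub>R v \<in> D"
    unfolding radial_def using that by (intro cSup_upper bdd) simp
qed

lemma radial_pos:
  assumes "v \<noteq> 0"
  shows "radial v > 0"
proof -
  obtain r where r: "r > 0" "cball c r \<subseteq> D" using center mem_interior_cball by blast
  then have "c + (r / norm v) *\<^sub>R v \<in> D"
    using assms by (intro subsetD[OF r(2)]) (simp add: dist_norm)
  then have "r / norm v \<le> radial v" using le_radial[OF assms] by blast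
  moreover have "r / norm v > 0" using r assms by simp
  ultimately show ?thesis by linarith
qed

lemma ray_point_in:
  assumes "v \<noteq> 0" "0 \<le> s" "s \<le> radial v"
  shows "c + s *\<^sub>R v \<in> D"
proof -
  have "(1 - s / radial v) *\<^sub>R c + (s / radial v) *\<^sub>R radial_point v \<in> D"
    using assms radial_pos[OF assms(1)]
    by (intro convexD[OF convex] center_in radial_point_in) auto
  also have "(1 - s / radial v) *\<^sub>R c + (s / radial v) *\<^sub>R radial_point v = c + s *\<^sub>R v"
    using radial_pos[OF assms(1)] by (simp add: algebra_simps)
  finally show ?thesis .
qed

lemma radial_point_in_frontier:
  assumes "v \<noteq> 0"
  shows "radial_point v \<in> frontier D"
proof -
  have "radial_point v \<notin> interior D"
  proof
    assume "radial_point v \<in> interior D"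
    then obtain r where r: "r > 0" "cball (radial_point v) r \<subseteq> D" using mem_interior_cball by blast
    have "c + (radial v + r / norm v) *\<^sub>R v \<in> D"
      using assms r(1) by (intro subsetD[OF r(2)]) (simp add: dist_norm algebra_simps)
    then have "radial v + r / norm v \<le> radial v" using le_radial[OF assms] by blast
    moreover have "r / norm v > 0" using r assms by simp
    ultimately show False by linarith
  qed
  then show ?thesis
    using radial_point_in[OF assms] closure_subset unfolding frontier_def by blast
qed

text \<open>Each of the two opposite rays from \<open>c\<close> meets \<open>D\<close> in an initial
  segment. This identifies the chord endpoints in terms of \<open>radial\<close>.\<close>

lemma line_Int_body:
  assumes "v \<noteq> 0"
  shows "range (\<lambda>s. c + s *\<^sub>R v) \<inter> D = closed_segment (radial_point v) (radial_point (- v))"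
proof -
  let ?a = "radial v" and ?b = "radial (- v)"
  have v': "- v \<noteq> 0" using assms by simp
  have a: "?a > 0" and b: "?b > 0" using radial_pos assms v' by blast+
  have iff: "c + s *\<^sub>R v \<in> D \<longleftrightarrow> - ?b \<le> s \<and> s \<le> ?a" for s
  proof
    assume "c + s *\<^sub>R v \<in> D"
    then show "- ?b \<le> s \<and> s \<le> ?a"
      using le_radial[OF assms, of s] le_radial[OF v', of "- s"] by simp
  next
    assume "- ?b \<le> s \<and> s \<le> ?a"
    then show "c + s *\<^sub>R v \<in> D"
      using ray_point_in[OF assms, of s] ray_point_in[OF v', of "- s"] by (cases "s \<ge> 0") auto
  qed
  have "closed_segment (radial_point v) (radial_point (- v))
      = (\<lambda>s. c + s *\<^sub>R v) ` closed_segment ?a (- ?b)"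
    using closed_segment_linear_image[of "\<lambda>s. s *\<^sub>R v" ?a "- ?b"]
    by (simp add: closed_segment_translation image_image linear_scaleR_left del: scaleR_minus_left
        flip: scaleR_minus_left[of ?b])
  also have "closed_segment ?a (- ?b) = {- ?b..?a}"
    using a b by (simp add: closed_segment_eq_real_ivl)
  finally show ?thesis using iff by auto
qed

text \<open>The gauge \<open>1 / radial\<close> is subadditive by convexity, and at most
  \<open>norm x / r\<close> on a vector \<open>x\<close> because \<open>D\<close> contains a ball of
  radius \<open>r\<close>. Apply this to \<open>w = v + (w - v)\<close>.\<close>

lemma inverse_radial_Lipschitz:
  obtains r where "r > 0"
    "\<And>v w. v \<noteq> 0 \<Longrightarrow> w \<noteq> 0 \<Longrightarrow> \<bar>1 / radial v - 1 / radial w\<bar> \<le> norm (v - w) / r"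
proof -
  obtain r where r: "r > 0" "cball c r \<subseteq> D" using center mem_interior_cball by blast
  have le: "1 / radial w \<le> 1 / radial v + norm (v - w) / r" if "v \<noteq> 0" "w \<noteq> 0" for v w
  proof (cases "v = w")
    case False
    define d where "d = norm (w - v)"
    \<comment> \<open>\<open>k\<close> is the bound to be proved for the gauge of \<open>w\<close>.
      Its two summands, divided by \<open>k\<close>, are the weights of a convex combination of
      \<open>radial_point v\<close> and \<open>y\<close> that equals
      \<open>c + (1 / k) *\<^sub>R w\<close>.\<close>
    define k where "k = 1 / radial v + d / r"
    have d: "d > 0" using False by (simp add: d_def)
    have pv: "radial v > 0" using radial_pos that by blast
    have k: "k > 0" using pv d r by (simp add: k_def add_pos_pos)
    define y where "y = c + (r / d) *\<^sub>R (w - v)"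
    have "y \<in> D"
      unfolding y_def using r d by (intro subsetD[OF r(2)]) (simp add: dist_norm d_def)
    moreover have "(1 / radial v) / k + (d / r) / k = 1"
      using k unfolding add_divide_distrib[symmetric] by (simp add: k_def)
    ultimately have "((1 / radial v) / k) *\<^sub>R radial_point v + ((d / r) / k) *\<^sub>R y \<in> D"
      using k pv d r that by (intro convexD[OF convex] radial_point_in) auto
    also have "((1 / radial v) / k) *\<^sub>R radial_point v + ((d / r) / k) *\<^sub>R y
      = ((1 / radial v) / k + (d / r) / k) *\<^sub>R c + (1 / k) *\<^sub>R v + (1 / k) *\<^sub>R (w - v)"
      using k pv d r by (simp add: y_def scaleR_add_right scaleR_add_left)
    also have "\<dots> = c + (1 / k) *\<^sub>R w"
      using \<open>(1 / radial v) / k + (d / r) / k = 1\<close> by (simp add: scaleR_diff_right)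
    finally have "1 / k \<le> radial w" using le_radial that by blast
    then have "1 / radial w \<le> k"
      using k radial_pos[OF that(2)] by (simp add: field_simps)
    then show ?thesis by (simp add: k_def d_def norm_minus_commute)
  qed simp
  show ?thesis
  proof (rule that[OF r(1)])
    fix v w :: 'a assume "v \<noteq> 0" "w \<noteq> 0"
    then show "\<bar>1 / radial v - 1 / radial w\<bar> \<le> norm (v - w) / r"
      using le[of v w] le[of w v] by (simp add: norm_minus_commute abs_le_iff)
  qed
qed

lemma radial_point_Lipschitz_at:
  assumes v: "v \<noteq> 0"
  obtains C d where "C > 0" "d > 0"
    "\<And>w. norm (w - v) < d \<Longrightarrow> w \<noteq> 0"
    "\<And>w. norm (w - v) < d \<Longrightarrow> radial v / 2 \<le> radial w"
    "\<And>w. norm (w - v) < d \<Longrightarrow> norm (radial_point w - radial_point v) \<le> C * norm (w - v)"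
proof -
  obtain r where r: "r > 0"
    and lip: "\<And>v w. v \<noteq> 0 \<Longrightarrow> w \<noteq> 0 \<Longrightarrow> \<bar>1 / radial v - 1 / radial w\<bar> \<le> norm (v - w) / r"
    using inverse_radial_Lipschitz by blast
  define k where "k = 1 / radial v"
  have pv: "radial v > 0" and k: "k > 0" using radial_pos[OF v] by (auto simp: k_def)
  \<comment> \<open>The first bound keeps \<open>w\<close> away from zero; the second keeps
    \<open>1 / radial w\<close> within \<open>k / 2\<close> of \<open>k\<close>, so that
    \<open>radial w\<close> is comparable to \<open>radial v\<close>.\<close>
  define d where "d = min (norm v) (r * k / 2)"
  define C where "C = 2 * radial v * (1 + radial v * norm v / r)"
  have main: "w \<noteq> 0 \<and> radial v / 2 \<le> radial w
      \<and> norm (radial_point w - radial_point v) \<le> C * norm (w - v)"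
    if w: "norm (w - v) < d" for w
  proof -
    have w0: "w \<noteq> 0" using w by (auto simp: d_def)
    have pw: "radial w > 0" using radial_pos[OF w0] .
    have diff: "\<bar>1 / radial w - k\<bar> \<le> norm (w - v) / r" using lip[OF w0 v] by (simp add: k_def)
    also have "\<dots> \<le> k / 2" using w r by (simp add: d_def field_simps)
    finally have bnd: "k / 2 \<le> 1 / radial w" "1 / radial w \<le> 2 * k" using k by linarith+
    have upper: "radial w \<le> 2 * radial v" using bnd(1) pv pw by (simp add: k_def field_simps)
    have lower: "radial v / 2 \<le> radial w" using bnd(2) pv pw by (simp add: k_def field_simps)
    have "radial w - radial v = - (radial w * radial v * (1 / radial w - k))"
      using pv pw by (simp add: k_def algebra_simps)
    then have "\<bar>radial w - radial v\<bar> = radial w * radial v * \<bar>1 / radial w - k\<bar>"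
      using pv pw by (simp add: abs_mult)
    also have "\<dots> \<le> radial w * radial v * (norm (w - v) / r)"
      using pv pw diff by (intro mult_left_mono) auto
    finally have rd: "\<bar>radial w - radial v\<bar> \<le> radial w * radial v * (norm (w - v) / r)" .
    \<comment> \<open>The displacement is split into a change of direction and a change of
      radius.\<close>
    have "radial_point w - radial_point v = radial w *\<^sub>R (w - v) + (radial w - radial v) *\<^sub>R v"
      by (simp add: algebra_simps)
    then have "norm (radial_point w - radial_point v)
        \<le> norm (radial w *\<^sub>R (w - v)) + norm ((radial w - radial v) *\<^sub>R v)"
      by (metis norm_triangle_ineq)
    also have "\<dots> = radial w * norm (w - v) + \<bar>radial w - radial v\<bar> * norm v"
      using pw by simp
    also have "\<dots> \<le> radial w * norm (w - v) + radial w * radial v * (norm (w - v) / r) * norm v"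
      using rd by (intro add_left_mono mult_right_mono) auto
    also have "\<dots> = radial w * ((1 + radial v * norm v / r) * norm (w - v))"
      by (simp add: algebra_simps)
    also have "\<dots> \<le> 2 * radial v * ((1 + radial v * norm v / r) * norm (w - v))"
      using upper pv r by (intro mult_right_mono) auto
    finally show ?thesis using w0 lower by (simp add: C_def mult.assoc)
  qed
  have "C > 0" using pv r unfolding C_def by (intro mult_pos_pos add_pos_nonneg) auto
  moreover have "d > 0" using v r k by (simp add: d_def)
  ultimately show ?thesis using main that by blast
qed

text \<open>A chain rule that asks only for a Lipschitz inner function: an error that is small
  relative to \<open>norm (X - radial_point v)\<close> along the frontier is small relative to
  \<open>norm (w - v)\<close>.\<close>

lemma radial_point_normal_derivative:
  assumes v: "v \<noteq> 0"
    and tangent: "((\<lambda>X. X \<bullet> n) has_derivative (\<lambda>_. 0)) (at (radial_point v) within frontier D)"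
  shows "((\<lambda>w. radial_point w \<bullet> n) has_derivative (\<lambda>_. 0)) (at v)"
proof -
  obtain C d where C: "C > 0" and d: "d > 0"
    and w0: "\<And>w. norm (w - v) < d \<Longrightarrow> w \<noteq> 0"
    and lip: "\<And>w. norm (w - v) < d \<Longrightarrow> norm (radial_point w - radial_point v) \<le> C * norm (w - v)"
    using radial_point_Lipschitz_at[OF v] by metis
  show ?thesis
    unfolding has_derivative_within_alt
  proof (intro conjI allI impI)
    fix e :: real assume e: "e > 0"
    then have "e / C > 0" using C by simp
    then obtain b where b: "b > 0" and small: "\<And>X. X \<in> frontier D \<Longrightarrow> norm (X - radial_point v) < b
        \<Longrightarrow> norm (X \<bullet> n - radial_point v \<bullet> n) \<le> e / C * norm (X - radial_point v)"
      using tangent unfolding has_derivative_within_alt by (metis diff_zero)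
    have "norm (radial_point w \<bullet> n - radial_point v \<bullet> n - 0) \<le> e * norm (w - v)"
      if w: "norm (w - v) < min d (b / C)" for w
    proof -
      have le: "norm (radial_point w - radial_point v) \<le> C * norm (w - v)" using lip w by simp
      also have "\<dots> < b" using w C by (simp add: field_simps)
      finally have "norm (radial_point w \<bullet> n - radial_point v \<bullet> n)
          \<le> e / C * norm (radial_point w - radial_point v)"
        using w by (intro small radial_point_in_frontier w0) auto
      also have "\<dots> \<le> e / C * (C * norm (w - v))"
        using le e C by (intro mult_left_mono) auto
      finally show ?thesis using C by simp
    qed
    moreover have "min d (b / C) > 0" using b C d by simp
    ultimately show "\<exists>d>0. \<forall>y\<in>UNIV. norm (y - v) < d \<longrightarrow>
        norm (radial_point y \<bullet> n - radial_point v \<bullet> n - 0) \<le> e * norm (y - v)" by blast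
  qed simp
qed

text \<open>Otherwise the hyperplane would pass through the centre, and moving \<open>v\<close> towards \<open>n\<close>
  would move the boundary point off the hyperplane at positive speed.\<close>
lemma tangent_transversal:
  assumes v: "v \<noteq> 0" and n: "n \<noteq> 0"
    and tangent: "((\<lambda>X. X \<bullet> n) has_derivative (\<lambda>_. 0)) (at (radial_point v) within frontier D)"
  shows "v \<bullet> n \<noteq> 0"
proof
  assume vn: "v \<bullet> n = 0"
  obtain d where d: "d > 0"
    and lower: "\<And>w. norm (w - v) < d \<Longrightarrow> radial v / 2 \<le> radial w"
    using radial_point_Lipschitz_at[OF v] by metis
  have pv: "radial v > 0" using radial_pos[OF v] .
  \<comment> \<open>Moving \<open>v\<close> by \<open>t *\<^sub>R n\<close> changes the inner
    product by at least \<open>radial v / 2 * (t * (norm n)\<^sup>2)\<close>. This \<open>e\<close>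
    allows only half of that.\<close>
  define e where "e = radial v * norm n / 4"
  have e: "e > 0" using pv n by (simp add: e_def)
  then obtain b where b: "b > 0" and small: "\<And>w. norm (w - v) < b
      \<Longrightarrow> norm (radial_point w \<bullet> n - radial_point v \<bullet> n) \<le> e * norm (w - v)"
    using radial_point_normal_derivative[OF v tangent] unfolding has_derivative_within_alt
    by (metis UNIV_I diff_zero)
  define t where "t = min d b / (2 * norm n)"
  define w where "w = v + t *\<^sub>R n"
  have t: "t > 0" using b d n by (simp add: t_def)
  have "norm (w - v) = t * norm n" using t by (simp add: w_def)
  moreover have "t * norm n = min d b / 2" using n by (simp add: t_def)
  ultimately have w: "norm (w - v) < d" "norm (w - v) < b" using b d by auto
  have "radial w * (t * (norm n)\<^sup>2) = radial_point w \<bullet> n - radial_point v \<bullet> n"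
    using vn by (simp add: w_def inner_simps power2_norm_eq_inner)
  also have "\<dots> \<le> e * (t * norm n)"
    using small[OF w(2)] \<open>norm (w - v) = t * norm n\<close> by simp
  also have "\<dots> = radial v / 4 * (t * (norm n)\<^sup>2)" by (simp add: e_def power2_eq_square)
  finally have "radial w \<le> radial v / 4" using t n by (simp add: mult_le_cancel_right)
  then show False using lower[OF w(1)] pv by linarith
qed

text \<open>Near \<open>v\<close>, \<open>radial w\<close> is the quotient of
  \<open>radial_point w \<bullet> n - c \<bullet> n\<close> by \<open>w \<bullet> n\<close>. The
  numerator has derivative zero and transversality keeps the denominator nonzero, so the quotient
  rule applies.\<close>

lemma radial_has_derivative:
  assumes v: "v \<noteq> 0" and n: "n \<noteq> 0"
    and tangent: "((\<lambda>X. X \<bullet> n) has_derivative (\<lambda>_. 0)) (at (radial_point v) within frontier D)"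
  shows "(radial has_derivative (\<lambda>h. - radial v * (h \<bullet> n) / (v \<bullet> n))) (at v)"
proof -
  have vn: "v \<bullet> n \<noteq> 0" using tangent_transversal[OF assms] .
  have "((\<lambda>w. (radial_point w \<bullet> n - c \<bullet> n) / (w \<bullet> n)) has_derivative
      (\<lambda>h. - radial v * (h \<bullet> n) / (v \<bullet> n))) (at v)"
    by (rule has_derivative_eq_rhs, (rule derivative_intros radial_point_normal_derivative v tangent vn)+)
      (use vn in \<open>simp add: fun_eq_iff inner_simps field_simps\<close>)
  moreover have "\<forall>\<^sub>F w in at v. (radial_point w \<bullet> n - c \<bullet> n) / (w \<bullet> n) = radial w"
  proof -
    have "\<forall>\<^sub>F w in nhds v. w \<bullet> n \<noteq> 0"
      using vn by (intro tendsto_imp_eventually_ne[where c="v \<bullet> n"] tendsto_intros filterlim_ident)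
    then show ?thesis
      unfolding eventually_at_filter by eventually_elim (simp add: inner_simps)
  qed
  ultimately show ?thesis
    using vn by (elim has_derivative_transform_eventually) (auto simp: inner_simps)
qed

end

section \<open>Lines, tangents and perpendiculars in coordinates\<close>

lemma is_lineE:
  assumes "is_line L" "c \<in> L"
  obtains u where "norm u = 1" "L = range (\<lambda>s. c + s *\<^sub>R u)"
proof -
  have L: "affine L" "aff_dim L = 1" using assms by (auto simp: is_line_def)
  obtain b where b: "b \<in> L" "b \<noteq> c"
  proof -
    have "L \<noteq> {c}" using L by auto
    then show ?thesis using that assms(2) by blast
  qed
  have "affine hull {c, b} = L"
  proof (rule affine_dim_equal)
    show "affine hull {c, b} \<subseteq> L" using b assms L by (intro hull_minimal) auto
    show "aff_dim (affine hull {c, b}) = aff_dim L" using b L by (simp add: aff_dim_2)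
  qed (use L in auto)
  then have L_eq: "L = range (\<lambda>s. c + s *\<^sub>R (b - c))"
    unfolding affine_hull_2_alt by auto
  define u where "u = (b - c) /\<^sub>R norm (b - c)"
  have "norm u = 1" using b by (simp add: u_def)
  moreover have "L = range (\<lambda>s. c + s *\<^sub>R u)"
  proof (intro set_eqI iffI)
    fix x assume "x \<in> L"
    then obtain s where "x = c + s *\<^sub>R (b - c)" using L_eq by auto
    then have "x = c + (s * norm (b - c)) *\<^sub>R u" using b by (simp add: u_def)
    then show "x \<in> range (\<lambda>s. c + s *\<^sub>R u)" by blast
  next
    fix x assume "x \<in> range (\<lambda>s. c + s *\<^sub>R u)"
    then obtain s where "x = c + (s / norm (b - c)) *\<^sub>R (b - c)" by (auto simp: u_def divide_inverse)
    then show "x \<in> L" using L_eq by blast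
  qed
  ultimately show ?thesis using that by blast
qed

text \<open>The ordinate over the tangent is \<open>(X - P) \<bullet> n\<close>. It is small
  relative to the change of abscissa, which is at most the distance from \<open>P\<close>. The
  origin of the coordinates is moved to \<open>P\<close> as well.\<close>

lemma tangent_atE:
  assumes "tangent_at p \<gamma> P"
  obtains e n where "norm e = 1" "norm n = 1" "e \<bullet> n = 0" "p = range (\<lambda>x. P + x *\<^sub>R e)"
    "((\<lambda>X. X \<bullet> n) has_derivative (\<lambda>_. 0)) (at P within \<gamma>)"
proof -
  obtain r q e n I g where r: "r > 0" and e: "norm e = 1" and n: "norm n = 1"
    and en: "orthogonal e n" and p: "p = range (\<lambda>x. q + x *\<^sub>R e)"
    and deriv: "(g has_real_derivative 0) (at ((P - q) \<bullet> e))"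
    and graph: "\<gamma> \<inter> ball P r = (\<lambda>x. q + x *\<^sub>R e + g x *\<^sub>R n) ` I"
    and Pp: "P \<in> p" and P\<gamma>: "P \<in> \<gamma>"
    using assms unfolding tangent_at_def Int_iff by (elim conjE exE) (rule that)
  have dots: "e \<bullet> e = 1" "n \<bullet> n = 1" "e \<bullet> n = 0" "n \<bullet> e = 0"
    using e n en by (auto simp: norm_eq_1 orthogonal_def inner_commute)
  obtain x0 where P: "P = q + x0 *\<^sub>R e" using Pp p by auto
  have x0: "(P - q) \<bullet> e = x0" by (simp add: P dots)
  have coord: "(X - P) \<bullet> e = x - x0" "(X - P) \<bullet> n = g x" if "X = q + x *\<^sub>R e + g x *\<^sub>R n" for X x
    unfolding that P by (simp_all add: inner_simps dots)
  \<comment> \<open>\<open>P\<close> lies on the graph and also on the abscissa axis.\<close>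
  have g0: "g x0 = 0"
  proof -
    have "P \<in> \<gamma> \<inter> ball P r" using P\<gamma> r by simp
    then obtain x where "P = q + x *\<^sub>R e + g x *\<^sub>R n" unfolding graph by blast
    from coord[OF this] show ?thesis by simp
  qed
  have "((\<lambda>X. X \<bullet> n) has_derivative (\<lambda>_. 0)) (at P within \<gamma>)"
    unfolding has_derivative_within_alt
  proof (intro conjI allI impI)
    fix \<epsilon> :: real assume "\<epsilon> > 0"
    then obtain d where d: "d > 0" and small: "\<And>x. norm (x - x0) < d \<Longrightarrow> norm (g x) \<le> \<epsilon> * norm (x - x0)"
      using deriv unfolding has_field_derivative_def has_derivative_within_alt x0 g0
      by (metis UNIV_I diff_zero mult_zero_left)
    have "norm (X \<bullet> n - P \<bullet> n - 0) \<le> \<epsilon> * norm (X - P)"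
      if X: "X \<in> \<gamma>" "norm (X - P) < min d r" for X
    proof -
      have "X \<in> \<gamma> \<inter> ball P r" using X by (simp add: dist_norm norm_minus_commute)
      then obtain x where x: "X = q + x *\<^sub>R e + g x *\<^sub>R n" unfolding graph by blast
      \<comment> \<open>Orthogonal projection onto the axis does not increase distances.\<close>
      have le: "norm (x - x0) \<le> norm (X - P)"
        using Cauchy_Schwarz_ineq2[of "X - P" e] coord[OF x] e by simp
      then have "norm (g x) \<le> \<epsilon> * norm (x - x0)" using small X by simp
      also have "\<dots> \<le> \<epsilon> * norm (X - P)" using le \<open>\<epsilon> > 0\<close> by simp
      finally show ?thesis using coord(2)[OF x] by (simp add: inner_simps)
    qed
    then show "\<exists>d>0. \<forall>y\<in>\<gamma>. norm (y - P) < d \<longrightarrow> norm (y \<bullet> n - P \<bullet> n - 0) \<le> \<epsilon> * norm (y - P)"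
      using d r by (intro exI[of _ "min d r"]) auto
  qed simp
  moreover have "p = range (\<lambda>x. P + x *\<^sub>R e)"
  proof -
    have "P + x *\<^sub>R e = q + (x0 + x) *\<^sub>R e" for x by (simp add: P algebra_simps)
    moreover have "q + x *\<^sub>R e = P + (x - x0) *\<^sub>R e" for x by (simp add: P algebra_simps)
    ultimately show ?thesis unfolding p by (blast intro: sym)
  qed
  ultimately show ?thesis using that e n dots by blast
qed

lemma perpendicular_at_line:
  assumes "L = range (\<lambda>x. P + x *\<^sub>R e)"
  shows "X \<in> perpendicular_at L Q \<longleftrightarrow> (X - Q) \<bullet> e = 0"
proof
  assume X: "X \<in> perpendicular_at L Q"
  have "P + 1 *\<^sub>R e \<in> L" "P + 0 *\<^sub>R e \<in> L" using assms by blast+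
  then have "orthogonal (X - Q) (P + 1 *\<^sub>R e - (P + 0 *\<^sub>R e))"
    using X unfolding perpendicular_at_def by blast
  then show "(X - Q) \<bullet> e = 0" by (simp add: orthogonal_def)
qed (auto simp: perpendicular_at_def assms orthogonal_def inner_diff_right inner_add_right)

section \<open>Quarter turns and normals in the plane\<close>

definition quarter_turn :: "real^2 \<Rightarrow> real^2" where
  "quarter_turn v = vector [- v $ 2, v $ 1]"

lemma quarter_turn_nth [simp]:
  "quarter_turn v $ 1 = - v $ 2" "quarter_turn v $ 2 = v $ 1"
  by (simp_all add: quarter_turn_def)

lemma inner_real2: "x \<bullet> y = x $ 1 * y $ 1 + x $ 2 * y $ 2" for x y :: "real^2"
  by (simp add: inner_vec_def sum_2)

lemma vec2_eq_iff: "x = y \<longleftrightarrow> x $ 1 = y $ 1 \<and> x $ 2 = y $ 2" for x y :: "real^2"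
  by (simp add: vec_eq_iff forall_2)

lemma rotation_eq: "rotation c \<phi> X = c + cos \<phi> *\<^sub>R (X - c) + sin \<phi> *\<^sub>R quarter_turn (X - c)"
  by (simp add: rotation_def vec2_eq_iff algebra_simps)

text \<open>In the coordinates \<open>u\<close>, \<open>quarter_turn u\<close> centred at \<open>c\<close>, the perpendicular to the line
  through \<open>c\<close> consists of the points with coordinates \<open>(0, \<mu>)\<close>; it meets the normal at the point
  \<open>(a, 0)\<close> where \<open>\<mu>\<close> is the value below.\<close>
lemma normal_meets_perpendicular_iff:
  fixes u e n :: "real^2"
  assumes "norm e = 1" "norm n = 1" "e \<bullet> n = 0" "u \<bullet> n \<noteq> 0"
  shows "(\<mu> *\<^sub>R quarter_turn u - a *\<^sub>R u) \<bullet> e = 0 \<longleftrightarrow> \<mu> = - a * (quarter_turn u \<bullet> n) / (u \<bullet> n)"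
proof -
  have n1: "n $ 1 * n $ 1 + n $ 2 * n $ 2 = 1" and e1: "e $ 1 * e $ 1 + e $ 2 * e $ 2 = 1"
    and en: "e $ 1 * n $ 1 + e $ 2 * n $ 2 = 0"
    using assms by (auto simp: norm_eq_1 inner_real2)
  \<comment> \<open>The inner product of \<open>quarter_turn n\<close> and \<open>e\<close>. In the
    plane, \<open>e\<close> orthogonal to the unit vector \<open>n\<close> must be this multiple of
    \<open>quarter_turn n\<close>.\<close>
  define s where "s = n $ 1 * e $ 2 - n $ 2 * e $ 1"
  have e2: "e = s *\<^sub>R quarter_turn n"
  proof -
    have "e $ 1 = - s * n $ 2" using n1 en unfolding s_def by algebra
    moreover have "e $ 2 = s * n $ 1" using n1 en unfolding s_def by algebra
    ultimately show ?thesis by (simp add: vec2_eq_iff)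
  qed
  have s: "s \<noteq> 0" using e1 unfolding e2 by auto
  have "(\<mu> *\<^sub>R quarter_turn u - a *\<^sub>R u) \<bullet> e = s * (\<mu> * (u \<bullet> n) + a * (quarter_turn u \<bullet> n))"
    unfolding e2 by (simp add: inner_real2 algebra_simps)
  also have "\<dots> = 0 \<longleftrightarrow> \<mu> * (u \<bullet> n) + a * (quarter_turn u \<bullet> n) = 0" using s by simp
  also have "\<dots> \<longleftrightarrow> \<mu> = - a * (quarter_turn u \<bullet> n) / (u \<bullet> n)"
    using assms(4) by (subst eq_divide_eq) (simp add: eq_neg_iff_add_eq_0)
  finally show ?thesis .
qed

lemma CPP_commute: "CPP l1 l2 l A B c \<longleftrightarrow> CPP l2 l1 l B A c"
  by (auto simp: CPP_def)

section \<open>The derivative of the chord length\<close>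

context
  fixes D :: "(real^2) set" and c :: "real^2"
  assumes body: "convex_body D c"
begin

interpretation convex_body D c by (fact body)

text \<open>The number \<open>m\<close> is the coordinate along \<open>quarter_turn (u \<phi>)\<close> of the point where the normal
  to the boundary meets the perpendicular at the centre.\<close>
lemma radial_rotation_derivative:
  fixes u :: "real \<Rightarrow> real^2"
  assumes u: "u \<phi> \<noteq> 0" "(u has_vector_derivative quarter_turn (u \<phi>)) (at \<phi>)"
    and p: "tangent_at p (frontier D) (radial_point (u \<phi>))"
  obtains m where "((\<lambda>\<psi>. radial (u \<psi>)) has_real_derivative m) (at \<phi>)"
    "\<And>\<mu>. c + \<mu> *\<^sub>R quarter_turn (u \<phi>) \<in> perpendicular_at p (radial_point (u \<phi>)) \<longleftrightarrow> \<mu> = m"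
proof -
  let ?P = "radial_point (u \<phi>)"
  obtain e n where en: "norm e = 1" "norm n = 1" "e \<bullet> n = 0"
    and p_eq: "p = range (\<lambda>x. ?P + x *\<^sub>R e)"
    and tan: "((\<lambda>X. X \<bullet> n) has_derivative (\<lambda>_. 0)) (at ?P within frontier D)"
    using tangent_atE[OF p] by blast
  have n: "n \<noteq> 0" using en by auto
  define m where "m = - radial (u \<phi>) * (quarter_turn (u \<phi>) \<bullet> n) / (u \<phi> \<bullet> n)"
  have "((\<lambda>\<psi>. radial (u \<psi>)) has_derivative
      (\<lambda>h. - radial (u \<phi>) * ((h *\<^sub>R quarter_turn (u \<phi>)) \<bullet> n) / (u \<phi> \<bullet> n))) (at \<phi>)"
    by (rule has_derivative_compose[OF u(2)[unfolded has_vector_derivative_def]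
          radial_has_derivative[OF u(1) n tan]])
  then have "((\<lambda>\<psi>. radial (u \<psi>)) has_real_derivative m) (at \<phi>)"
    unfolding has_field_derivative_def
    by (rule has_derivative_eq_rhs) (simp add: fun_eq_iff m_def)
  moreover have "c + \<mu> *\<^sub>R quarter_turn (u \<phi>) \<in> perpendicular_at p ?P \<longleftrightarrow> \<mu> = m" for \<mu>
  proof -
    have "(c + \<mu> *\<^sub>R quarter_turn (u \<phi>)) - ?P = \<mu> *\<^sub>R quarter_turn (u \<phi>) - radial (u \<phi>) *\<^sub>R u \<phi>" by simp
    then show ?thesis
      unfolding perpendicular_at_line[OF p_eq] m_def
      using normal_meets_perpendicular_iff[OF en tangent_transversal[OF u(1) n tan]] by simp
  qed
  ultimately show ?thesis using that by blast
qed

text \<open>The heights \<open>m1\<close> and \<open>m2\<close> are measured along opposite axes,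
  since a quarter turn of \<open>- u \<phi>\<close> is the negative of that of
  \<open>u \<phi>\<close>. A common point of the three perpendiculars therefore means
  \<open>m1 = - m2\<close>.\<close>

lemma chord_length_derivative:
  fixes u :: "real \<Rightarrow> real^2"
  assumes u: "u \<phi> \<noteq> 0" "(u has_vector_derivative quarter_turn (u \<phi>)) (at \<phi>)"
    and t1: "tangent_at t1 (frontier D) (radial_point (u \<phi>))"
    and t2: "tangent_at t2 (frontier D) (radial_point (- u \<phi>))"
  obtains f' where "((\<lambda>\<psi>. radial (u \<psi>) + radial (- u \<psi>)) has_real_derivative f') (at \<phi>)"
    "f' = 0 \<longleftrightarrow> CPP t1 t2 (range (\<lambda>s. c + s *\<^sub>R u \<phi>)) (radial_point (u \<phi>)) (radial_point (- u \<phi>)) c"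
proof -
  have minus: "- quarter_turn v = quarter_turn (- v)" for v by (simp add: vec2_eq_iff)
  obtain m1 where m1: "((\<lambda>\<psi>. radial (u \<psi>)) has_real_derivative m1) (at \<phi>)"
    "\<And>\<mu>. c + \<mu> *\<^sub>R quarter_turn (u \<phi>) \<in> perpendicular_at t1 (radial_point (u \<phi>)) \<longleftrightarrow> \<mu> = m1"
    using radial_rotation_derivative[OF u t1] by blast
  have u': "- u \<phi> \<noteq> 0" "((\<lambda>\<psi>. - u \<psi>) has_vector_derivative quarter_turn (- u \<phi>)) (at \<phi>)"
    using u has_vector_derivative_minus[OF u(2)] by (auto simp: minus)
  obtain m2 where m2: "((\<lambda>\<psi>. radial (- u \<psi>)) has_real_derivative m2) (at \<phi>)"
    "\<And>\<mu>. c + \<mu> *\<^sub>R quarter_turn (- u \<phi>) \<in> perpendicular_at t2 (radial_point (- u \<phi>)) \<longleftrightarrow> \<mu> = m2"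
    using radial_rotation_derivative[OF u' t2] by blast
  have m2': "c + \<mu> *\<^sub>R quarter_turn (u \<phi>) \<in> perpendicular_at t2 (radial_point (- u \<phi>)) \<longleftrightarrow> - \<mu> = m2" for \<mu>
    using m2(2)[of "- \<mu>"] by (simp flip: minus)
  have perp: "X \<in> perpendicular_at (range (\<lambda>s. c + s *\<^sub>R u \<phi>)) c
      \<longleftrightarrow> (\<exists>\<mu>. X = c + \<mu> *\<^sub>R quarter_turn (u \<phi>))" for X
  proof -
    have "(X - c) \<bullet> u \<phi> = 0 \<longleftrightarrow> (\<exists>\<mu>. X = c + \<mu> *\<^sub>R quarter_turn (u \<phi>))"
    proof
      let ?v = "u \<phi>" and ?w = "X - c"
      assume "?w \<bullet> ?v = 0"
      then have w: "?w $ 1 * ?v $ 1 + ?w $ 2 * ?v $ 2 = 0" by (simp add: inner_real2)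
      have q: "?v \<bullet> ?v \<noteq> 0" using u(1) by simp
      let ?k = "quarter_turn ?v \<bullet> ?w"
      \<comment> \<open>Expansion of \<open>?w\<close> along \<open>quarter_turn ?v\<close>, with
        the denominator cleared because \<open>?v\<close> need not be a unit vector here.\<close>
      have "(?v \<bullet> ?v) *\<^sub>R ?w = ?k *\<^sub>R quarter_turn ?v"
      proof -
        have "(?v \<bullet> ?v) * ?w $ 1 = - ?k * ?v $ 2" "(?v \<bullet> ?v) * ?w $ 2 = ?k * ?v $ 1"
          using w unfolding inner_real2 quarter_turn_nth by algebra+
        then show ?thesis by (simp add: vec2_eq_iff)
      qed
      then have "?w = (?k / (?v \<bullet> ?v)) *\<^sub>R quarter_turn ?v"
        using q by (metis (no_types, lifting) divide_inverse_commute scaleR_one scaleR_scaleR left_inverse)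
      then show "\<exists>\<mu>. X = c + \<mu> *\<^sub>R quarter_turn ?v" by (metis add.commute diff_add_cancel)
    qed (auto simp: inner_real2)
    then show ?thesis by (simp add: perpendicular_at_line[OF refl])
  qed
  have "CPP t1 t2 (range (\<lambda>s. c + s *\<^sub>R u \<phi>)) (radial_point (u \<phi>)) (radial_point (- u \<phi>)) c
      \<longleftrightarrow> (\<exists>\<mu>. c + \<mu> *\<^sub>R quarter_turn (u \<phi>) \<in> perpendicular_at t1 (radial_point (u \<phi>))
          \<and> c + \<mu> *\<^sub>R quarter_turn (u \<phi>) \<in> perpendicular_at t2 (radial_point (- u \<phi>)))"
    by (auto simp: CPP_def perp set_eq_iff)
  also have "\<dots> \<longleftrightarrow> m1 + m2 = 0" unfolding m1(2) m2' by auto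
  finally show ?thesis using that[OF DERIV_add[OF m1(1) m2(1)]] by blast
qed

end

theorem proposition10:
  fixes D :: "(real^2) set" and c :: "real^2" and l0 :: "(real^2) set"
    and l :: "real \<Rightarrow> (real^2) set"
    and A B :: "real \<Rightarrow> real^2"
    and t1 t2 :: "real \<Rightarrow> (real^2) set"
    and f :: "real \<Rightarrow> real"
  assumes "compact D" and "convex D" and "smooth_boundary D"
    and "c \<in> interior D"
    and "is_line l0" and "c \<in> l0"
    and "\<And>\<phi>. l \<phi> = rotation c \<phi> ` l0"
    and "\<And>\<phi>. closed_segment (A \<phi>) (B \<phi>) = l \<phi> \<inter> D"
    and "\<And>\<phi>. f \<phi> = dist (A \<phi>) (B \<phi>)"
    and "\<And>\<phi>. tangent_at (t1 \<phi>) (frontier D) (A \<phi>)"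
    and "\<And>\<phi>. tangent_at (t2 \<phi>) (frontier D) (B \<phi>)"
  shows "(\<forall>\<phi>. f differentiable (at \<phi>)) \<and>
    (\<forall>\<phi>. deriv f \<phi> = 0 \<longleftrightarrow> CPP (t1 \<phi>) (t2 \<phi>) (l \<phi>) (A \<phi>) (B \<phi>) c)"
proof -
  interpret convex_body D c using assms by unfold_locales
  obtain v where v: "norm v = 1" "l0 = range (\<lambda>s. c + s *\<^sub>R v)"
    using is_lineE assms(5,6) by blast
  define u where "u \<phi> = cos \<phi> *\<^sub>R v + sin \<phi> *\<^sub>R quarter_turn v" for \<phi>
  have l: "l \<phi> = range (\<lambda>s. c + s *\<^sub>R u \<phi>)" for \<phi>
  proof -
    have "rotation c \<phi> (c + s *\<^sub>R v) = c + s *\<^sub>R u \<phi>" for s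
      by (simp add: rotation_eq u_def vec2_eq_iff algebra_simps)
    then show ?thesis by (simp add: assms(7) v(2) image_image)
  qed
  have norm_u: "norm (u \<phi>) = 1" for \<phi>
  proof -
    have v1: "v $ 1 * v $ 1 + v $ 2 * v $ 2 = 1" using v(1) by (simp add: norm_eq_1 inner_real2)
    have cs: "cos \<phi> * cos \<phi> + sin \<phi> * sin \<phi> = 1"
      using sin_cos_squared_add3[of \<phi>] by (simp add: mult.commute)
    have "u \<phi> $ 1 = cos \<phi> * v $ 1 - sin \<phi> * v $ 2" "u \<phi> $ 2 = cos \<phi> * v $ 2 + sin \<phi> * v $ 1"
      by (simp_all add: u_def)
    then show ?thesis using v1 cs unfolding norm_eq_1 inner_real2 by algebra
  qed
  then have u0: "u \<phi> \<noteq> 0" for \<phi> by (metis norm_zero zero_neq_one)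
  have du: "(u has_vector_derivative quarter_turn (u \<phi>)) (at \<phi>)" for \<phi>
    unfolding u_def
    by (rule has_vector_derivative_eq_rhs, (rule derivative_intros)+)
      (simp_all add: vec2_eq_iff)
  \<comment> \<open>A segment fixes its endpoints only up to order, so which of the two is
    \<open>A \<phi>\<close> may change from one angle to another.\<close>
  have ends: "A \<phi> = radial_point (u \<phi>) \<and> B \<phi> = radial_point (- u \<phi>) \<or>
      A \<phi> = radial_point (- u \<phi>) \<and> B \<phi> = radial_point (u \<phi>)" for \<phi>
  proof -
    have "closed_segment (A \<phi>) (B \<phi>) = closed_segment (radial_point (u \<phi>)) (radial_point (- u \<phi>))"
      unfolding assms(8) l line_Int_body[OF u0] ..
    then show ?thesis unfolding closed_segment_eq doubleton_eq_iff by blast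
  qed
  \<comment> \<open>The length does not depend on that order, so a single formula holds at all
    angles even if the labels jump. This is what allows differentiating \<open>f\<close>.\<close>
  have f: "f = (\<lambda>\<phi>. radial (u \<phi>) + radial (- u \<phi>))"
  proof
    fix \<phi>
    have "radial (u \<phi>) > 0" "radial (- u \<phi>) > 0" using radial_pos u0 by simp_all
    moreover have "dist (radial_point (u \<phi>)) (radial_point (- u \<phi>))
        = norm ((radial (u \<phi>) + radial (- u \<phi>)) *\<^sub>R u \<phi>)"
      by (simp add: dist_norm algebra_simps)
    ultimately have "dist (radial_point (u \<phi>)) (radial_point (- u \<phi>)) = radial (u \<phi>) + radial (- u \<phi>)"
      using norm_u by simp
    then show "f \<phi> = radial (u \<phi>) + radial (- u \<phi>)"
      using ends[of \<phi>] assms(9)[of \<phi>] by (auto simp: dist_commute)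
  qed
  have "\<exists>f'. (f has_real_derivative f') (at \<phi>) \<and>
      (f' = 0 \<longleftrightarrow> CPP (t1 \<phi>) (t2 \<phi>) (l \<phi>) (A \<phi>) (B \<phi>) c)" for \<phi>
    using ends[of \<phi>]
  proof (elim disjE conjE)
    assume AB: "A \<phi> = radial_point (u \<phi>)" "B \<phi> = radial_point (- u \<phi>)"
    show ?thesis
      using chord_length_derivative[OF convex_body_axioms u0 du
          assms(10)[of \<phi>, unfolded AB] assms(11)[of \<phi>, unfolded AB]]
      unfolding AB f l by blast
  next
    \<comment> \<open>With the labels exchanged, the tangents exchange roles too; concurrency is
      symmetric under this.\<close>
    assume AB: "A \<phi> = radial_point (- u \<phi>)" "B \<phi> = radial_point (u \<phi>)"
    show ?thesis
      using chord_length_derivative[OF convex_body_axioms u0 du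
          assms(11)[of \<phi>, unfolded AB] assms(10)[of \<phi>, unfolded AB]]
      unfolding AB f l CPP_commute[of "t1 \<phi>"] by blast
  qed
  then show ?thesis
    by (metis DERIV_imp_deriv real_differentiable_def)
qed

end
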